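(* Let $A\in\mathbb{C}^{n\times n}$ have index $k\ge 1$, with $\operatorname{rank}(A^{\sim}AA^{\sim})=\operatorname{rank}(A)>0$ and $A^{k}\neq 0$. Let $$A=B_1C_1,\quad C_1B_1=B_2C_2,\quad C_2B_2=B_3C_3,\ \dots,\ C_{k-1}B_{k-1}=B_kC_k$$ be such that $B_1C_1$ is a full-rank factorization of $A$ and $B_{i+1}C_{i+1}$ is a full-rank factorization of $C_iB_i$ for $i=1,2,\dots,k-1$. Then $$A^{D,\mathfrak{m}}=B_1\cdots B_k(C_kB_k)^{-k}C_k\cdots C_2(B_1^{\sim}B_1)^{-1}B_1^{\sim}.$$
   Context: A full-rank factorization of a matrix $M$ of rank $s>0$ is $M=BC$ with $B$ having $s$ columns and full column rank and $C$ having $s$ rows and full row rank. For $k=1$ the product $C_k\cdots C_2$ is empty (the identity). The index of $A\in\mathbb{C}^{n\times n}$ is the smallest nonnegative integer $k$ with $\operatorname{rank}(A^{k+1})=\operatorname{rank}(A^{k})$. The Minkowski metric matrix of order $p$ is $\operatorname{diag}(1,-I_{p-1})$. For $M\in\mathbb{C}^{m\times p}$, the Minkowski adjoint is $M^{\sim}=GM^{*}F$, where $M^*$ is the conjugate transpose and $G$ and $F$ are the Minkowski metric matrices of orders $p$ and $m$, respectively. The Drazin inverse $A^{D}$ of $A$ (of index $k$) is the unique $X$ with $XAX=X$, $AX=XA$, $A^{k+1}X=A^{k}$. The Minkowski inverse $A^{\mathfrak{m}}$ is the unique matrix $X$ (if it exists) with $AXA=A$, $XAX=X$, $(AX)^{\sim}=AX$,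 $(XA)^{\sim}=XA$; it exists if and only if $\operatorname{rank}(A^{\sim}AA^{\sim})=\operatorname{rank}(A)$. When it exists, the $\mathfrak{m}$-DMP inverse of $A$ is $A^{D,\mathfrak{m}}=A^{D}AA^{\mathfrak{m}}$. *)

theory Defs
  imports
    Complex_Main
    "Jordan_Normal_Form.DL_Rank"
    "Jordan_Normal_Form.Schur_Decomposition"
    "Jordan_Normal_Form.Gauss_Jordan_Elimination"
begin

text \<open>Matrices are the carrier-based \<open>complex mat\<close> because the ranks of the successive
  factors, and hence the sizes of the matrices involved, vary within one statement.\<close>

definition mat_rank :: "complex mat \<Rightarrow> nat" where
  "mat_rank M = vec_space.rank (dim_row M) M"

text \<open>Only meaningful for an invertible argument.\<close>
definition mat_inv :: "complex mat \<Rightarrow> complex mat" where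
  "mat_inv M = the (mat_inverse M)"

text \<open>The argument \<open>m\<close> is the number of rows of the product; it matters only for the empty
  product, which is the identity of order \<open>m\<close>.\<close>
definition mat_prod_list :: "nat \<Rightarrow> complex mat list \<Rightarrow> complex mat" where
  "mat_prod_list m Ms = foldl (*) (1\<^sub>m m) Ms"

definition full_rank_factorization :: "complex mat \<Rightarrow> complex mat \<Rightarrow> complex mat \<Rightarrow> bool" where
  "full_rank_factorization M B C \<longleftrightarrow>
     mat_rank M > 0 \<and>
     B \<in> carrier_mat (dim_row M) (mat_rank M) \<and> mat_rank B = dim_col B \<and>
     C \<in> carrier_mat (mat_rank M) (dim_col M) \<and> mat_rank C = dim_row C \<and>
     M = B * C"

definition mat_index :: "complex mat \<Rightarrow> nat" where
  "mat_index A = (LEAST k. mat_rank (A ^\<^sub>m (k + 1)) = mat_rank (A ^\<^sub>m k))"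

definition minkowski_metric :: "nat \<Rightarrow> complex mat" where
  "minkowski_metric p = mat_diag p (\<lambda>i. if i = 0 then 1 else - 1)"

definition minkowski_adjoint :: "complex mat \<Rightarrow> complex mat" where
  "minkowski_adjoint M =
     minkowski_metric (dim_col M) * mat_adjoint M * minkowski_metric (dim_row M)"

definition is_drazin_inverse :: "complex mat \<Rightarrow> complex mat \<Rightarrow> bool" where
  "is_drazin_inverse A X \<longleftrightarrow>
     X \<in> carrier_mat (dim_row A) (dim_row A) \<and>
     X * A * X = X \<and> A * X = X * A \<and>
     A ^\<^sub>m (mat_index A + 1) * X = A ^\<^sub>m mat_index A"

definition drazin_inverse :: "complex mat \<Rightarrow> complex mat" where
  "drazin_inverse A = (THE X. is_drazin_inverse A X)"

definition is_minkowski_inverse :: "complex mat \<Rightarrow> complex mat \<Rightarrow> bool" where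
  "is_minkowski_inverse A X \<longleftrightarrow>
     X \<in> carrier_mat (dim_col A) (dim_row A) \<and>
     A * X * A = A \<and> X * A * X = X \<and>
     minkowski_adjoint (A * X) = A * X \<and> minkowski_adjoint (X * A) = X * A"

text \<open>The Minkowski inverse exists iff \<open>A\<^sup>~ A A\<^sup>~\<close> has the same rank as \<open>A\<close>; otherwise the
  value below, and that of \<open>m_DMP_inverse\<close>, is unspecified.\<close>
definition minkowski_inverse :: "complex mat \<Rightarrow> complex mat" where
  "minkowski_inverse A = (THE X. is_minkowski_inverse A X)"

definition m_DMP_inverse :: "complex mat \<Rightarrow> complex mat" where
  "m_DMP_inverse A = drazin_inverse A * A * minkowski_inverse A"

end

theory Submission
  imports Defs
begin

text \<open>Put \<open>D\<^sub>0 = A\<close> and \<open>D\<^sub>i = C\<^sub>i B\<^sub>i\<close>, so that each \<open>B\<^sub>i\<^sub>+\<^sub>1 C\<^sub>i\<^sub>+\<^sub>1\<close> is a full-rank factorization of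
  \<open>D\<^sub>i\<close>, and write \<open>P\<^sub>i = B\<^sub>1 \<cdots> B\<^sub>i\<close> and \<open>Q\<^sub>i = C\<^sub>i \<cdots> C\<^sub>1\<close>.  Passing from \<open>BC\<close> to \<open>CB\<close> at every stage
  gives \<open>A P\<^sub>i = P\<^sub>i D\<^sub>i\<close> and \<open>Q\<^sub>i A = D\<^sub>i Q\<^sub>i\<close> (\<open>intertwine_P\<close>, \<open>intertwine_Q\<close>), hence
  \<open>A\<^sup>i = P\<^sub>i Q\<^sub>i\<close>, \<open>A\<^sup>i\<^sup>+\<^sup>1 = P\<^sub>i D\<^sub>i Q\<^sub>i\<close> and \<open>Q\<^sub>i P\<^sub>i = D\<^sub>i\<^sup>i\<close>.

  Full column rank of the \<open>B\<^sub>i\<close> makes \<open>P\<^sub>k\<close> left invertible, full row rank of the \<open>C\<^sub>i\<close> makes \<open>Q\<^sub>k\<close> right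
  invertible.  So the rank of \<open>A\<^sup>k\<close> is the order of \<open>D\<^sub>k\<close>, while the rank of \<open>A\<^sup>k\<^sup>+\<^sup>1\<close> is at most that of
  \<open>D\<^sub>k\<close>; at the index both ranks agree, and \<open>D\<^sub>k\<close> is invertible (\<open>D_index_invertible\<close>).  It follows
  that \<open>P\<^sub>k D\<^sub>k\<^sup>-\<^sup>k\<^sup>-\<^sup>1 Q\<^sub>k\<close> satisfies the equations of the Drazin inverse
  (\<open>drazin_inverse_of_factorization\<close>), so that \<open>A\<^sup>D A = P\<^sub>k D\<^sub>k\<^sup>-\<^sup>k Q\<^sub>k\<close>.

  The rank hypothesis on \<open>A\<^sup>~ A A\<^sup>~ = C\<^sub>1\<^sup>~ (B\<^sub>1\<^sup>~ B\<^sub>1) (C\<^sub>1 C\<^sub>1\<^sup>~) B\<^sub>1\<^sup>~\<close> bounds from below the ranks of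
  the two inner factors, square matrices whose order is the rank of \<open>A\<close>; both are therefore invertible, and
  the Minkowski inverse is \<open>C\<^sub>1\<^sup>~ (C\<^sub>1 C\<^sub>1\<^sup>~)\<^sup>-\<^sup>1 (B\<^sub>1\<^sup>~ B\<^sub>1)\<^sup>-\<^sup>1 B\<^sub>1\<^sup>~\<close>
  (\<open>minkowski_inverse_of_factorization\<close>).  In the product \<open>A\<^sup>D A A\<^sup>m\<close> the last factor \<open>C\<^sub>1\<close> of \<open>Q\<^sub>k\<close>
  meets \<open>C\<^sub>1\<^sup>~ (C\<^sub>1 C\<^sub>1\<^sup>~)\<^sup>-\<^sup>1\<close> and cancels, which leaves the claimed formula.\<close>

section \<open>Associativity, powers and inverses of matrices\<close>

text \<open>Stated with dimension conditions, which the simplifier can discharge, in place of membership in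
  carriers: as a rewrite rule it normalizes products of rectangular matrices.\<close>
lemma mat_mult_assoc:
  assumes "dim_col X = dim_row Y" "dim_col Y = dim_row Z"
  shows "X * Y * Z = X * (Y * Z)"
  using assms assoc_mult_mat[of X "dim_row X" "dim_col X" Y "dim_col Y" Z "dim_col Z"]
  by (metis carrier_mat_triv)

lemma mat_mult_cancel_left:
  fixes X Y Z :: "'a::semiring_1 mat"
  assumes "X * Y = 1\<^sub>m m" "dim_col X = dim_row Y" "dim_col Y = dim_row Z" "dim_row Z = m"
  shows "X * (Y * Z) = Z"
proof -
  have "X * (Y * Z) = X * Y * Z" using mat_mult_assoc[OF assms(2,3)] by (rule sym)
  also have "\<dots> = Z" unfolding assms(1) by (rule left_mult_one_mat[OF carrier_matI[OF assms(4) refl]])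
  finally show ?thesis .
qed

lemma pow_mat_commute:
  assumes A: "A \<in> carrier_mat n n" and X: "X \<in> carrier_mat n n" and "X * A = A * X"
  shows "X * A ^\<^sub>m j = A ^\<^sub>m j * X"
proof (induction j)
  case (Suc j)
  have "X * A ^\<^sub>m Suc j = X * A ^\<^sub>m j * A" using A X by (simp add: mat_mult_assoc)
  also have "\<dots> = A ^\<^sub>m j * (X * A)" using A X Suc by (simp add: mat_mult_assoc)
  finally show ?case using A X assms(3) by (simp add: mat_mult_assoc)
qed (use A X in simp)

lemma pow_mat_left_right_inverse:
  assumes D: "D \<in> carrier_mat r r" and E: "E \<in> carrier_mat r r" and "D * E = 1\<^sub>m r"
  shows "D ^\<^sub>m j * E ^\<^sub>m j = 1\<^sub>m r"
proof (induction j)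
  case (Suc j)
  have "D ^\<^sub>m Suc j * E ^\<^sub>m Suc j = D ^\<^sub>m j * D * (E * E ^\<^sub>m j)"
    using pow_mat_commute[OF E E refl] by simp
  also have "\<dots> = D ^\<^sub>m j * E ^\<^sub>m j"
    using D E assms(3) by (simp add: mat_mult_assoc mat_mult_cancel_left[where m = r])
  finally show ?case using Suc by simp
qed (use D E in simp)

lemma mat_inv_left_right:
  assumes "X \<in> carrier_mat m m" "invertible_mat X"
  shows "mat_inv X \<in> carrier_mat m m" "X * mat_inv X = 1\<^sub>m m" "mat_inv X * X = 1\<^sub>m m"
proof -
  obtain Y where Y: "X * Y = 1\<^sub>m (dim_row X)" "Y * X = 1\<^sub>m (dim_row Y)"
    using assms(2) unfolding invertible_mat_def inverts_mat_def by blast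
  have cY: "Y \<in> carrier_mat m m" using Y assms(1)
    by (metis carrier_matD carrier_matI index_mult_mat(2,3) index_one_mat(2,3))
  have "X \<in> Units (ring_mat TYPE(complex) m ())"
    using Y cY assms(1) unfolding Units_def ring_mat_def by auto
  then obtain Z where "mat_inverse X = Some Z"
    using mat_inverse(1)[OF assms(1), of "()"] by (cases "mat_inverse X") auto
  with mat_inverse(2)[OF assms(1) this]
  show "mat_inv X \<in> carrier_mat m m" "X * mat_inv X = 1\<^sub>m m" "mat_inv X * X = 1\<^sub>m m"
    unfolding mat_inv_def by auto
qed

section \<open>Rank and full-rank matrices\<close>

text \<open>A maximal independent set of columns spans the column space.\<close>
lemma (in vec_space) rank_basis_of_columns:
  assumes A: "A \<in> carrier_mat n nc"
  obtains S where "finite S" "S \<subseteq> carrier_vec n" "lin_indpt S" "card S = rank A"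
    "span S = span (set (cols A))"
proof -
  have cA: "set (cols A) \<subseteq> carrier_vec n" using A cols_dim by blast
  obtain S where fin: "finite S" and max: "maximal S (\<lambda>T. T \<subseteq> set (cols A) \<and> lin_indpt T)"
    using maximal_exists[of "\<lambda>T. T \<subseteq> set (cols A) \<and> lin_indpt T" "card (set (cols A))" "{}"]
    by (meson List.finite_set card_mono empty_iff empty_subsetI finite_lin_indpt2 rev_finite_subset)
  have S: "S \<subseteq> set (cols A)" and li: "lin_indpt S" using max unfolding maximal_def by auto
  have cS: "S \<subseteq> carrier_vec n" using S cA by blast
  have "s \<in> span S" if s: "s \<in> set (cols A)" for s
  proof (rule ccontr)
    assume ns: "s \<notin> span S"
    have "lin_indpt (insert s S)"
      using lin_dep_iff_in_span[of S s] cS li ns s cA span_mem[of S s] by auto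
    then have "insert s S = S" using max S s unfolding maximal_def by auto
    then show False using ns span_mem[of S s] cS by auto
  qed
  then have "span (set (cols A)) \<subseteq> span S" using span_subsetI[OF cS] by blast
  moreover have "span S \<subseteq> span (set (cols A))" using span_is_monotone[OF S] .
  moreover have "card S = rank A" using rank_card_indpt[OF A max] by simp
  ultimately show ?thesis using that fin cS li by blast
qed

text \<open>Take a basis of the column space as the columns of the left factor; the columns of the right factor are
  the coordinates of the columns of \<open>A\<close>.\<close>
lemma (in vec_space) rank_factorization_exists:
  assumes A: "A \<in> carrier_mat n nc"
  obtains P Q where "P \<in> carrier_mat n (rank A)" "Q \<in> carrier_mat (rank A) nc" "A = P * Q"
proof -
  obtain S where S: "finite S" "S \<subseteq> carrier_vec n" "card S = rank A"
    "span S = span (set (cols A))" using rank_basis_of_columns[OF A] by metis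
  obtain ss where ss: "set ss = S" "distinct ss" using finite_distinct_list[OF S(1)] by blast
  let ?P = "mat_of_cols n ss"
  have len: "length ss = rank A" using ss S(3) distinct_card by force
  have P: "?P \<in> carrier_mat n (rank A)" using len by auto
  have colsP: "set (cols ?P) = S" using ss S(2) by (simp add: cols_mat_of_cols)
  have "\<exists>x \<in> carrier_vec (rank A). ?P *\<^sub>v x = col A j" if j: "j < nc" for j
  proof -
    have "col A j \<in> set (cols A)" using j A by (metis carrier_matD(2) cols_length cols_nth nth_mem)
    then have "col A j \<in> col_space ?P"
      unfolding col_space_def colsP S(4) using span_mem[of "set (cols A)"] A cols_dim by blast
    then show ?thesis unfolding col_space_eq[OF P] using P len by auto
  qed
  then obtain x where x: "\<And>j. j < nc \<Longrightarrow> x j \<in> carrier_vec (rank A) \<and> ?P *\<^sub>v x j = col A j"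
    by metis
  let ?Q = "mat_of_cols (rank A) (map x [0..<nc])"
  have Q: "?Q \<in> carrier_mat (rank A) nc" by auto
  have "A = ?P * ?Q"
  proof (rule eq_matI)
    fix i j assume "i < dim_row (?P * ?Q)" "j < dim_col (?P * ?Q)"
    then have ij: "i < n" "j < nc" using P Q by auto
    have "col ?Q j = x j" using ij x by (simp add: col_mat_of_cols)
    then have "(?P * ?Q) $$ (i, j) = (?P *\<^sub>v x j) $ i" using ij P Q by simp
    then show "A $$ (i, j) = (?P * ?Q) $$ (i, j)" using x[OF ij(2)] ij A by simp
  qed (use A P Q in auto)
  then show ?thesis using that P Q by blast
qed

text \<open>The column space of \<open>P Q\<close> lies in that of \<open>P\<close>.\<close>
lemma (in vec_space) rank_mult_le:
  assumes P: "P \<in> carrier_mat n r" and Q: "Q \<in> carrier_mat r nc"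
  shows "rank (P * Q) \<le> rank P"
proof -
  let ?W = "span (set (cols P))"
  have PQ: "P * Q \<in> carrier_mat n nc" using P Q by auto
  have cP: "set (cols P) \<subseteq> carrier_vec n" using P cols_dim by blast
  have sub: "submodule class_ring ?W V" using cP span_is_submodule by simp
  interpret W: vectorspace class_ring "vs ?W"
    using cP span_is_subspace subspace_def subspace_is_vs by simp
  obtain S where S: "finite S" "S \<subseteq> carrier_vec n" "lin_indpt S" "card S = rank (P * Q)"
    "span S = span (set (cols (P * Q)))" using rank_basis_of_columns[OF PQ] by metis
  have "col_space (P * Q) \<subseteq> col_space P"
  proof
    fix y assume "y \<in> col_space (P * Q)"
    then obtain x where x: "x \<in> carrier_vec nc" "y = (P * Q) *\<^sub>v x"
      using col_space_eq[OF PQ] Q by auto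
    then have "y = P *\<^sub>v (Q *\<^sub>v x)" using P Q by (simp add: assoc_mult_mat_vec)
    then show "y \<in> col_space P" using col_space_eq[OF P] P Q x by auto
  qed
  then have SW: "S \<subseteq> ?W" using S(5) in_own_span[of S] S(2) unfolding col_space_def by auto
  have "W.lin_indpt S" using span_li_not_depend(2)[OF SW sub] S(3) by simp
  then have "card S \<le> W.dim" using W.li_le_dim(2)[of S] SW fin_dim_span_cols[OF P] by auto
  then show ?thesis using S(4) unfolding rank_def by simp
qed

text \<open>The columns span the whole space, so every unit vector is a value of \<open>A\<close>.\<close>
lemma (in vec_space) full_row_rank_right_inverse:
  assumes A: "A \<in> carrier_mat n nc" and r: "rank A = n"
  obtains R where "R \<in> carrier_mat nc n" "A * R = 1\<^sub>m n"
proof -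
  obtain S where S: "finite S" "S \<subseteq> carrier_vec n" "lin_indpt S" "card S = rank A"
    "span S = span (set (cols A))" using rank_basis_of_columns[OF A] by metis
  have "basis S" using dim_li_is_basis[of S] S r dim_is_n by simp
  then have cs: "col_space A = carrier_vec n" using S(5) unfolding basis_def col_space_def by simp
  have "\<exists>x \<in> carrier_vec nc. A *\<^sub>v x = unit_vec n j" for j
  proof -
    have "unit_vec n j \<in> col_space A" using cs by simp
    then show ?thesis using col_space_eq[OF A] A by auto
  qed
  then obtain x where x: "\<And>j. x j \<in> carrier_vec nc \<and> A *\<^sub>v x j = unit_vec n j"
    by metis
  let ?R = "mat_of_cols nc (map x [0..<n])"
  have "A * ?R = 1\<^sub>m n"
  proof (rule eq_matI)
    fix i j assume "i < dim_row (1\<^sub>m n)" "j < dim_col (1\<^sub>m n)"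
    then have ij: "i < n" "j < n" by auto
    have "col ?R j = x j" using ij x by (simp add: col_mat_of_cols)
    then have "(A * ?R) $$ (i, j) = (A *\<^sub>v x j) $ i" using ij A by simp
    then show "(A * ?R) $$ (i, j) = 1\<^sub>m n $$ (i, j)" using x[of j] ij by simp
  qed (use A in auto)
  moreover have "?R \<in> carrier_mat nc n" using mat_of_cols_carrier(1)[of nc "map x [0..<n]"] by simp
  ultimately show ?thesis using that by blast
qed

lemma mat_rank_mult_le_left:
  assumes "dim_col P = dim_row Q"
  shows "mat_rank (P * Q) \<le> mat_rank P"
proof -
  have "P \<in> carrier_mat (dim_row P) (dim_row Q)" "Q \<in> carrier_mat (dim_row Q) (dim_col Q)"
    by (rule carrier_matI[OF refl assms], rule carrier_matI[OF refl refl])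
  from vec_space.rank_mult_le[OF this] show ?thesis unfolding mat_rank_def index_mult_mat .
qed

lemma mat_rank_le_dim_col: "mat_rank P \<le> dim_col P"
  unfolding mat_rank_def using vec_space.rank_le_nc by blast

lemma mat_rank_factorization:
  obtains P Q where "P \<in> carrier_mat (dim_row M) (mat_rank M)"
    "Q \<in> carrier_mat (mat_rank M) (dim_col M)" "M = P * Q"
proof -
  have "M \<in> carrier_mat (dim_row M) (dim_col M)" by simp
  from vec_space.rank_factorization_exists[OF this] show ?thesis using that
    unfolding mat_rank_def by metis
qed

lemma mat_rank_mult_le_inner:
  assumes "P \<in> carrier_mat m r" "Q \<in> carrier_mat r p"
  shows "mat_rank (P * Q) \<le> r"
proof -
  have "mat_rank (P * Q) \<le> mat_rank P"
    by (rule mat_rank_mult_le_left) (simp add: carrier_matD[OF assms(1)] carrier_matD[OF assms(2)])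
  also have "\<dots> \<le> r" using mat_rank_le_dim_col[of P] unfolding carrier_matD[OF assms(1)] .
  finally show ?thesis .
qed

text \<open>A rank factorization \<open>Q = X Y\<close> turns \<open>P Q\<close> into \<open>(P X) Y\<close>, with inner dimension the rank of \<open>Q\<close>.\<close>
lemma mat_rank_mult_le_right:
  assumes "dim_col P = dim_row Q"
  shows "mat_rank (P * Q) \<le> mat_rank Q"
proof -
  obtain X Y where XY: "X \<in> carrier_mat (dim_row Q) (mat_rank Q)"
    "Y \<in> carrier_mat (mat_rank Q) (dim_col Q)" "Q = X * Y"
    using mat_rank_factorization .
  have "dim_col P = dim_row X" "dim_col X = dim_row Y" using XY(1,2) assms by auto
  then have "P * Q = P * X * Y" by (subst XY(3)) (simp add: mat_mult_assoc)
  moreover have "P * X \<in> carrier_mat (dim_row P) (mat_rank Q)"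
    by (rule mult_carrier_mat[OF carrier_matI[OF refl assms] XY(1)])
  then have "mat_rank (P * X * Y) \<le> mat_rank Q" by (rule mat_rank_mult_le_inner) (rule XY(2))
  ultimately show ?thesis by (simp only:)
qed

text \<open>Transposing a rank factorization keeps its inner dimension.\<close>
lemma mat_rank_transpose_le: "mat_rank M\<^sup>T \<le> mat_rank M"
proof -
  obtain P Q where PQ: "P \<in> carrier_mat (dim_row M) (mat_rank M)"
    "Q \<in> carrier_mat (mat_rank M) (dim_col M)" "M = P * Q"
    using mat_rank_factorization .
  have "M\<^sup>T = Q\<^sup>T * P\<^sup>T" by (subst PQ(3)) (rule transpose_mult[OF PQ(1,2)])
  then show ?thesis
    using mat_rank_mult_le_inner[of "Q\<^sup>T" _ "mat_rank M" "P\<^sup>T"] PQ(1,2) by auto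
qed

lemma mat_rank_transpose: "mat_rank M\<^sup>T = mat_rank M"
  using mat_rank_transpose_le[of M] mat_rank_transpose_le[of "M\<^sup>T"] by simp

lemma full_row_rank_right_inverse:
  assumes "mat_rank M = dim_row M"
  obtains R where "R \<in> carrier_mat (dim_col M) (dim_row M)" "M * R = 1\<^sub>m (dim_row M)"
proof -
  have "M \<in> carrier_mat (dim_row M) (dim_col M)" by simp
  then show ?thesis
    by (rule vec_space.full_row_rank_right_inverse[OF _ assms[unfolded mat_rank_def]]) (rule that)
qed

lemma full_column_rank_left_inverse:
  assumes "mat_rank M = dim_col M"
  obtains L where "L \<in> carrier_mat (dim_col M) (dim_row M)" "L * M = 1\<^sub>m (dim_col M)"
proof -
  obtain R where R: "R \<in> carrier_mat (dim_row M) (dim_col M)" "M\<^sup>T * R = 1\<^sub>m (dim_col M)"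
    using full_row_rank_right_inverse[of "M\<^sup>T"] assms mat_rank_transpose[of M]
    unfolding index_transpose_mat by metis
  have "(M\<^sup>T * R)\<^sup>T = R\<^sup>T * M"
    using transpose_mult[OF _ R(1), of "M\<^sup>T" "dim_col M"] by simp
  then have "R\<^sup>T * M = 1\<^sub>m (dim_col M)" unfolding R(2) by simp
  then show ?thesis using that[of "R\<^sup>T"] R(1) transpose_carrier_mat by blast
qed

lemma full_rank_invertible:
  assumes M: "M \<in> carrier_mat r r" and "r \<le> mat_rank M"
  shows "invertible_mat M"
proof -
  have "mat_rank M = r" using assms mat_rank_le_dim_col[of M] by auto
  then obtain R where R: "R \<in> carrier_mat r r" "M * R = 1\<^sub>m r"
    using full_row_rank_right_inverse[of M] carrier_matD[OF M] by metis
  then have "R * M = 1\<^sub>m r" using mat_mult_left_right_inverse M by blast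
  then show ?thesis using R M unfolding invertible_mat_def inverts_mat_def by auto
qed

lemma mat_rank_one [simp]: "mat_rank (1\<^sub>m r) = r"
proof -
  have "det (1\<^sub>m r :: complex mat) \<noteq> 0" by simp
  then have "vec_space.rank r (1\<^sub>m r :: complex mat) = r"
    using vec_space.det_rank_iff[OF one_carrier_mat, where 'a = complex] by metis
  then show ?thesis by (simp add: mat_rank_def)
qed

text \<open>The ranks of the powers decrease weakly, so they cannot drop forever; hence the minimum that defines the
  index is attained.\<close>
lemma mat_index_rank_stable:
  assumes A: "A \<in> carrier_mat n n"
  shows "mat_rank (A ^\<^sub>m (mat_index A + 1)) = mat_rank (A ^\<^sub>m mat_index A)"
proof -
  have "\<exists>k. mat_rank (A ^\<^sub>m (k + 1)) = mat_rank (A ^\<^sub>m k)"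
  proof (rule ccontr)
    assume "\<nexists>k. mat_rank (A ^\<^sub>m (k + 1)) = mat_rank (A ^\<^sub>m k)"
    moreover have "mat_rank (A ^\<^sub>m (k + 1)) \<le> mat_rank (A ^\<^sub>m k)" for k
      using mat_rank_mult_le_left[of "A ^\<^sub>m k" A] A by simp
    ultimately have less: "mat_rank (A ^\<^sub>m (k + 1)) < mat_rank (A ^\<^sub>m k)" for k
      using le_neq_implies_less by blast
    have "mat_rank (A ^\<^sub>m k) + k \<le> mat_rank (A ^\<^sub>m 0)" for k
    proof (induction k)
      case (Suc k)
      then show ?case using less[of k] by simp
    qed simp
    from this[of "Suc (mat_rank (A ^\<^sub>m 0))"] show False by simp
  qed
  then show ?thesis unfolding mat_index_def by (rule LeastI_ex)
qed

section \<open>The Minkowski adjoint\<close>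

text \<open>With the two metric matrices multiplied out, the laws of the adjoint become computations with entries.\<close>
lemma minkowski_adjoint_index:
  "minkowski_adjoint M = mat (dim_col M) (dim_row M)
     (\<lambda>(i, j). (if i = 0 then 1 else - 1) * cnj (M $$ (j, i)) * (if j = 0 then 1 else - 1))"
proof -
  have adj: "mat_adjoint M = mat (dim_col M) (dim_row M) (\<lambda>(i, j). cnj (M $$ (j, i)))"
    by (rule eq_matI) (auto simp: mat_adjoint_def mat_of_rows_def)
  show ?thesis
    unfolding minkowski_adjoint_def minkowski_metric_def adj
    by (subst mat_diag_mult_left[of _ _ "dim_row M"], simp,
        subst mat_diag_mult_right[of _ "dim_col M"], simp) (rule eq_matI, auto)
qed

lemma minkowski_adjoint_dim [simp]:
  "dim_row (minkowski_adjoint M) = dim_col M" "dim_col (minkowski_adjoint M) = dim_row M"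
  by (simp_all add: minkowski_adjoint_index)

lemma minkowski_adjoint_involution [simp]: "minkowski_adjoint (minkowski_adjoint M) = M"
  unfolding minkowski_adjoint_index by (rule eq_matI) auto

lemma minkowski_adjoint_mult:
  assumes "dim_col M = dim_row N"
  shows "minkowski_adjoint (M * N) = minkowski_adjoint N * minkowski_adjoint M"
  unfolding minkowski_adjoint_index using assms
  by (intro eq_matI) (auto simp: scalar_prod_def sum_distrib_left sum_distrib_right ac_simps sum_negf
     intro!: sum.cong)

lemma minkowski_adjoint_one [simp]: "minkowski_adjoint (1\<^sub>m m) = 1\<^sub>m m"
  unfolding minkowski_adjoint_index by (rule eq_matI) auto

section \<open>Drazin and Minkowski inverses\<close>

text \<open>Since \<open>X = X\<^sup>2 A\<close> and \<open>Y = A Y\<^sup>2\<close>, one can write \<open>X = Z A\<^sup>k\<close> and \<open>Y = A\<^sup>k W\<close>.  As \<open>A X\<close> and \<open>A Y\<close> both fix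
  \<open>A\<^sup>k\<close>, the product \<open>X A Y\<close> equals \<open>X\<close> and equals \<open>Y\<close>.\<close>
lemma drazin_inverse_unique:
  assumes A: "A \<in> carrier_mat n n" and X: "is_drazin_inverse A X" and Y: "is_drazin_inverse A Y"
  shows "X = Y"
proof -
  define k where "k = mat_index A"
  have c: "X \<in> carrier_mat n n" "Y \<in> carrier_mat n n"
    using A X Y unfolding is_drazin_inverse_def by auto
  have X': "X * A * X = X" "A * X = X * A" "A ^\<^sub>m (k + 1) * X = A ^\<^sub>m k"
    and Y': "Y * A * Y = Y" "A * Y = Y * A" "A ^\<^sub>m (k + 1) * Y = A ^\<^sub>m k"
    using X Y unfolding is_drazin_inverse_def k_def by blast+
  have AX: "A ^\<^sub>m k * (A * X) = A ^\<^sub>m k" and AY: "A ^\<^sub>m k * (A * Y) = A ^\<^sub>m k"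
    using X'(3) Y'(3) A c by (simp_all add: mat_mult_assoc)
  have left: "\<exists>Z \<in> carrier_mat n n. X = Z * A ^\<^sub>m j" for j
  proof (induction j)
    case (Suc j)
    then obtain Z where Z: "Z \<in> carrier_mat n n" "X = Z * A ^\<^sub>m j" by blast
    have "X = X * (X * A)" using X'(1,2) A c by (simp add: mat_mult_assoc)
    also have "\<dots> = X * (Z * A ^\<^sub>m j * A)" using Z(2) by simp
    also have "\<dots> = (X * Z) * A ^\<^sub>m Suc j" using A c Z(1) by (simp add: mat_mult_assoc)
    finally show ?case using c Z(1) by (meson mult_carrier_mat)
  qed (use c A in force)
  have right: "\<exists>Z \<in> carrier_mat n n. Y = A ^\<^sub>m j * Z" for j
  proof (induction j)
    case (Suc j)
    then obtain Z where Z: "Z \<in> carrier_mat n n" "Y = A ^\<^sub>m j * Z" by blast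
    have "Y = A * Y * Y" using Y'(1,2) by simp
    also have "\<dots> = A * (A ^\<^sub>m j * Z) * Y" using Z(2) by simp
    also have "\<dots> = A ^\<^sub>m Suc j * (Z * Y)"
      using A c Z(1) pow_mat_commute[OF A A refl, of j] by (simp add: mat_mult_assoc[symmetric])
    finally show ?case using c Z(1) by (meson mult_carrier_mat)
  qed (use c A in force)
  obtain Z where Z: "Z \<in> carrier_mat n n" "X = Z * A ^\<^sub>m k" using left by blast
  obtain W where W: "W \<in> carrier_mat n n" "Y = A ^\<^sub>m k * W" using right by blast
  have Ak: "A ^\<^sub>m k \<in> carrier_mat n n" using A by simp
  have "X * (A * Y) = Z * (A ^\<^sub>m k * (A * Y))"
    using A c Z(1) Ak unfolding Z(2) by (simp add: mat_mult_assoc)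
  then have X_eq: "X * (A * Y) = X" using AY Z(2) by simp
  have "A * (X * A ^\<^sub>m k) = A * A ^\<^sub>m k * X"
    using pow_mat_commute[OF A c(1) X'(2)[symmetric]] A c by (simp add: mat_mult_assoc)
  also have "\<dots> = A ^\<^sub>m k"
    using AX pow_mat_commute[OF A A refl, of k] A c by (simp add: mat_mult_assoc)
  finally have "A * (X * A ^\<^sub>m k) * W = A ^\<^sub>m k * W" by simp
  then have "A * X * Y = Y" using A c W(1) Ak unfolding W(2) by (simp add: mat_mult_assoc)
  then have "X * (A * Y) = Y" unfolding X'(2) using A c by (simp add: mat_mult_assoc)
  then show ?thesis using X_eq by simp
qed

lemma drazin_inverse_eqI:
  assumes "A \<in> carrier_mat n n" "is_drazin_inverse A X"
  shows "drazin_inverse A = X"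
  unfolding drazin_inverse_def using assms drazin_inverse_unique by blast

text \<open>Penrose's argument.  As \<open>A X = (A Y) (A X)\<close> and both factors are self-adjoint, taking adjoints gives
  \<open>A X = (A X) (A Y) = A Y\<close>; likewise \<open>X A = Y A\<close>.\<close>
lemma minkowski_inverse_unique:
  assumes X: "is_minkowski_inverse A X" and Y: "is_minkowski_inverse A Y"
  shows "X = Y"
proof -
  have d: "dim_row X = dim_col A" "dim_col X = dim_row A" "dim_row Y = dim_col A" "dim_col Y = dim_row A"
    using X Y unfolding is_minkowski_inverse_def by auto
  have X': "A * X * A = A" "X * A * X = X" "minkowski_adjoint (A * X) = A * X"
      "minkowski_adjoint (X * A) = X * A"
    and Y': "A * Y * A = A" "Y * A * Y = Y" "minkowski_adjoint (A * Y) = A * Y"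
      "minkowski_adjoint (Y * A) = Y * A"
    using X Y unfolding is_minkowski_inverse_def by auto
  have "A * X = minkowski_adjoint (A * Y * (A * X))"
    using X' Y' d mat_mult_assoc[of "A * Y" A X] by simp
  also have "\<dots> = A * X * (A * Y)" using X' Y' d by (simp add: minkowski_adjoint_mult)
  also have "\<dots> = A * Y" using X' d mat_mult_assoc[of "A * X" A Y] by simp
  finally have AX: "A * X = A * Y" .
  have "X * A = minkowski_adjoint (X * A * (Y * A))"
    using X' Y' d mat_mult_assoc[of X A "Y * A"] mat_mult_assoc[of A Y A] by simp
  also have "\<dots> = Y * A * (X * A)" using X' Y' d by (simp add: minkowski_adjoint_mult)
  also have "\<dots> = Y * A" using X' d mat_mult_assoc[of Y A "X * A"] mat_mult_assoc[of A X A] by simp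
  finally have XA: "X * A = Y * A" .
  have "X = X * (A * X)" using X' d mat_mult_assoc[of X A X] by simp
  also have "\<dots> = X * A * Y" unfolding AX using d mat_mult_assoc[of X A Y] by simp
  also have "\<dots> = Y" unfolding XA using Y' by simp
  finally show ?thesis .
qed

lemma minkowski_inverse_eqI:
  assumes "is_minkowski_inverse A X"
  shows "minkowski_inverse A = X"
  unfolding minkowski_inverse_def using assms minkowski_inverse_unique by blast

lemma minkowski_adjoint_inverse:
  assumes "X \<in> carrier_mat m m" "Y \<in> carrier_mat m m" "X * Y = 1\<^sub>m m"
    and "minkowski_adjoint X = X"
  shows "minkowski_adjoint Y = Y"
proof -
  have YX: "Y * X = 1\<^sub>m m" using assms mat_mult_left_right_inverse by blast
  have "minkowski_adjoint Y * X = 1\<^sub>m m"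
    using assms minkowski_adjoint_mult[of X Y] by simp
  then have "minkowski_adjoint Y * X * Y = Y" using assms(2) by simp
  then show ?thesis using assms by (simp add: mat_mult_assoc)
qed

text \<open>The Minkowski analogue of MacDuffee's formula for the Moore-Penrose inverse.  For this \<open>X\<close> the
  products are \<open>(B C) X = B (B\<^sup>~ B)\<^sup>-\<^sup>1 B\<^sup>~\<close> and \<open>X (B C) = C\<^sup>~ (C C\<^sup>~)\<^sup>-\<^sup>1 C\<close>, which are visibly self-adjoint.\<close>
lemma minkowski_inverse_of_factorization:
  fixes B C :: "complex mat"
  assumes B: "B \<in> carrier_mat m s" and C: "C \<in> carrier_mat s p"
    and invB: "invertible_mat (minkowski_adjoint B * B)"
    and invC: "invertible_mat (C * minkowski_adjoint C)"
  shows "minkowski_inverse (B * C) = minkowski_adjoint C * mat_inv (C * minkowski_adjoint C) *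
    (mat_inv (minkowski_adjoint B * B) * minkowski_adjoint B)"
proof -
  define U V where "U = mat_inv (minkowski_adjoint B * B)" and "V = mat_inv (C * minkowski_adjoint C)"
  let ?B' = "minkowski_adjoint B" and ?C' = "minkowski_adjoint C"
  have d: "dim_row B = m" "dim_col B = s" "dim_row C = s" "dim_col C = p" using B C by auto
  have cB: "?B' * B \<in> carrier_mat s s" and cC: "C * ?C' \<in> carrier_mat s s" using d by auto
  note U = mat_inv_left_right[OF cB invB, folded U_def]
  note V = mat_inv_left_right[OF cC invC, folded V_def]
  have dUV: "dim_row U = s" "dim_col U = s" "dim_row V = s" "dim_col V = s" using U V by auto
  have adjU: "minkowski_adjoint U = U"
    by (rule minkowski_adjoint_inverse[OF cB U(1,2)]) (simp add: d minkowski_adjoint_mult)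
  have adjV: "minkowski_adjoint V = V"
    by (rule minkowski_adjoint_inverse[OF cC V(1,2)]) (simp add: d minkowski_adjoint_mult)
  let ?X = "?C' * V * (U * ?B')"
  have cancelV: "C * (?C' * (V * Z)) = Z" if "dim_row Z = s" for Z
    using mat_mult_cancel_left[OF V(2), of Z] that d dUV by (simp add: mat_mult_assoc)
  have cancelU: "U * (?B' * (B * Z)) = Z" if "dim_row Z = s" for Z
    using mat_mult_cancel_left[OF U(3), of Z] that d dUV by (simp add: mat_mult_assoc)
  have BCX: "B * C * ?X = B * (U * ?B')"
    using d dUV cancelV by (simp add: mat_mult_assoc)
  have XBC: "?X * (B * C) = ?C' * (V * C)"
    using d dUV cancelU by (simp add: mat_mult_assoc)
  have "?X \<in> carrier_mat (dim_col (B * C)) (dim_row (B * C))" by (rule carrier_matI) simp_all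
  then have "is_minkowski_inverse (B * C) ?X"
    unfolding is_minkowski_inverse_def BCX XBC
    using d dUV cancelU cancelV adjU adjV by (simp add: minkowski_adjoint_mult mat_mult_assoc)
  then show ?thesis unfolding U_def V_def by (rule minkowski_inverse_eqI)
qed

text \<open>The intertwining relations move \<open>A\<close> past \<open>P\<close> or \<open>Q\<close>, where it becomes \<open>D\<close> and cancels one factor \<open>E\<close>:
  for \<open>X = P E\<^sup>k\<^sup>+\<^sup>1 Q\<close> both \<open>A X\<close> and \<open>X A\<close> are \<open>P E\<^sup>k Q\<close>.  The remaining equations hold because
  \<open>Q P = D\<^sup>k\<close> cancels \<open>E\<^sup>k\<close>.\<close>
lemma drazin_inverse_of_factorization:
  assumes A: "A \<in> carrier_mat n n" and P: "P \<in> carrier_mat n r" and Q: "Q \<in> carrier_mat r n"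
    and D: "D \<in> carrier_mat r r" and E: "E \<in> carrier_mat r r"
    and DE: "D * E = 1\<^sub>m r" and k: "mat_index A = k"
    and Ak: "A ^\<^sub>m k = P * Q" and AP: "A * P = P * D" and QA: "Q * A = D * Q"
    and QP: "Q * P = D ^\<^sub>m k"
  shows "drazin_inverse A = P * E ^\<^sub>m (k + 1) * Q"
proof (rule drazin_inverse_eqI[OF A])
  let ?E = "E ^\<^sub>m (k + 1)"
  let ?X = "P * ?E * Q"
  have d: "dim_row A = n" "dim_col A = n" "dim_row P = n" "dim_col P = r" "dim_row Q = r"
    "dim_col Q = n" "dim_row D = r" "dim_col D = r" "dim_row ?E = r" "dim_col ?E = r"
    using A P Q D E by auto
  have E': "E * D = 1\<^sub>m r" using mat_mult_left_right_inverse[OF D E DE] .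
  have "D * ?E = D * (E * E ^\<^sub>m k)" using pow_mat_commute[OF E E refl, of k] by simp
  then have DE1: "D * ?E = E ^\<^sub>m k" using DE D E by (simp add: mat_mult_cancel_left[where m = r])
  have ED1: "?E * D = E ^\<^sub>m k" using E' D E by (simp add: mat_mult_assoc)
  have DkE: "D ^\<^sub>m k * E ^\<^sub>m k = 1\<^sub>m r" by (rule pow_mat_left_right_inverse[OF D E DE])
  have AX: "A * ?X = P * E ^\<^sub>m k * Q"
  proof -
    have "A * ?X = (A * P) * ?E * Q" using d by (simp add: mat_mult_assoc)
    also have "\<dots> = P * (D * ?E) * Q" unfolding AP using d by (simp add: mat_mult_assoc)
    finally show ?thesis unfolding DE1 .
  qed
  have XA: "?X * A = P * E ^\<^sub>m k * Q"
  proof -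
    have "?X * A = P * ?E * (Q * A)" using d by (simp add: mat_mult_assoc)
    also have "\<dots> = P * (?E * D) * Q" unfolding QA using d by (simp add: mat_mult_assoc)
    finally show ?thesis unfolding ED1 .
  qed
  have "?X * A * ?X = P * E ^\<^sub>m k * (Q * P) * ?E * Q"
    unfolding XA using d E by (simp add: mat_mult_assoc)
  also have "\<dots> = P * (E ^\<^sub>m k * D ^\<^sub>m k) * ?E * Q"
    unfolding QP using d E D by (simp add: mat_mult_assoc)
  also have "\<dots> = ?X"
    unfolding pow_mat_left_right_inverse[OF E D E'] using P by simp
  finally have XAX: "?X * A * ?X = ?X" .
  have "A ^\<^sub>m (k + 1) * ?X = A ^\<^sub>m k * (A * ?X)" using d A by (simp add: mat_mult_assoc)
  also have "\<dots> = P * (Q * P) * E ^\<^sub>m k * Q"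
    unfolding AX Ak using d E by (simp add: mat_mult_assoc)
  also have "\<dots> = P * (D ^\<^sub>m k * E ^\<^sub>m k) * Q"
    unfolding QP using d E D by (simp add: mat_mult_assoc)
  also have "\<dots> = A ^\<^sub>m k" unfolding DkE Ak using P by simp
  finally have "A ^\<^sub>m (k + 1) * ?X = A ^\<^sub>m k" .
  moreover have "?X \<in> carrier_mat (dim_row A) (dim_row A)" by (rule carrier_matI) (simp_all add: d)
  moreover have "A * ?X = ?X * A" unfolding AX XA ..
  ultimately show "is_drazin_inverse A ?X" unfolding is_drazin_inverse_def k using XAX by blast
qed

section \<open>Iterated full-rank factorizations\<close>

lemma full_rank_factorizationD:
  assumes "full_rank_factorization M B C"
  shows "M = B * C" "dim_row B = dim_row M" "dim_col C = dim_col M" "dim_row C = dim_col B"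
    "mat_rank M = dim_col B" "mat_rank B = dim_col B" "mat_rank C = dim_row C"
  using assms unfolding full_rank_factorization_def by auto

lemma mat_prod_list_snoc: "mat_prod_list m (Ms @ [M]) = mat_prod_list m Ms * M"
  unfolding mat_prod_list_def by simp

text \<open>This is \<open>C\<^sub>i \<cdots> C\<^sub>1\<close>: each new factor of the chain acts on the left.\<close>
primrec right_prod :: "nat \<Rightarrow> (nat \<Rightarrow> complex mat) \<Rightarrow> nat \<Rightarrow> complex mat" where
  "right_prod n C 0 = 1\<^sub>m n"
| "right_prod n C (Suc i) = C (Suc i) * right_prod n C i"

text \<open>The sequence \<open>D\<close> with \<open>D\<^sub>0 = A\<close> makes the factorization of \<open>A\<close> itself the first instance of the
  general step.\<close>
locale iterated_factorization =
  fixes n k :: nat and A :: "complex mat" and B C D :: "nat \<Rightarrow> complex mat"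
  assumes D_0: "D 0 = A" and D_Suc: "\<And>i. i < k \<Longrightarrow> D (Suc i) = C (Suc i) * B (Suc i)"
    and A: "A \<in> carrier_mat n n"
    and step: "\<And>i. i < k \<Longrightarrow> full_rank_factorization (D i) (B (Suc i)) (C (Suc i))"
begin

definition r where "r i = dim_row (D i)"

abbreviation P where "P i \<equiv> mat_prod_list n (map B [1..<i + 1])"
abbreviation Q where "Q i \<equiv> right_prod n C i"

lemma D_carrier: "i \<le> k \<Longrightarrow> D i \<in> carrier_mat (r i) (r i)"
proof (cases i)
  case (Suc j)
  assume "i \<le> k"
  then show ?thesis using D_Suc[of j] full_rank_factorizationD(4)[OF step, of j] Suc
    by (intro carrier_matI) (simp_all add: r_def)
qed (use A in \<open>simp add: D_0 r_def\<close>)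

lemma r_0: "r 0 = n"
  using A by (simp add: r_def D_0)

lemma r_Suc: "i < k \<Longrightarrow> r (Suc i) = mat_rank (D i)"
  using D_Suc full_rank_factorizationD(4,5)[OF step] by (simp add: r_def)

lemma factors:
  assumes "i < k"
  shows "B (Suc i) \<in> carrier_mat (r i) (r (Suc i))" "C (Suc i) \<in> carrier_mat (r (Suc i)) (r i)"
    "D i = B (Suc i) * C (Suc i)"
proof -
  note D = carrier_matD[OF D_carrier[OF less_imp_le[OF assms]]]
  note f = full_rank_factorizationD(1-5)[OF step[OF assms]]
  show "B (Suc i) \<in> carrier_mat (r i) (r (Suc i))"
    by (rule carrier_matI) (simp_all add: f(2) D r_Suc[OF assms] f(5))
  show "C (Suc i) \<in> carrier_mat (r (Suc i)) (r i)"
    by (rule carrier_matI) (simp_all add: f(3,4) D r_Suc[OF assms] f(5))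
  show "D i = B (Suc i) * C (Suc i)" by (rule f(1))
qed

lemma P_Suc: "P (Suc i) = P i * B (Suc i)" using mat_prod_list_snoc by simp

lemma P_carrier: "i \<le> k \<Longrightarrow> P i \<in> carrier_mat n (r i)"
proof (induction i)
  case (Suc i)
  then show ?case using factors(1)[of i] unfolding P_Suc by auto
qed (simp add: mat_prod_list_def r_0)

lemma Q_carrier: "i \<le> k \<Longrightarrow> Q i \<in> carrier_mat (r i) n"
proof (induction i)
  case (Suc i)
  then show ?case using factors(2)[of i] by auto
qed (simp add: r_0)

text \<open>Both intertwining relations come from \<open>D\<^sub>i B\<^sub>i\<^sub>+\<^sub>1 = B\<^sub>i\<^sub>+\<^sub>1 C\<^sub>i\<^sub>+\<^sub>1 B\<^sub>i\<^sub>+\<^sub>1 = B\<^sub>i\<^sub>+\<^sub>1 D\<^sub>i\<^sub>+\<^sub>1\<close> and its mirror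
  image for \<open>C\<^sub>i\<^sub>+\<^sub>1\<close>.\<close>
lemma intertwine_P: "i \<le> k \<Longrightarrow> A * P i = P i * D i"
proof (induction i)
  case (Suc i)
  note c = A P_carrier[of i] factors[of i]
  have "A * P (Suc i) = A * P i * B (Suc i)" unfolding P_Suc using c Suc.prems by (simp add: mat_mult_assoc)
  also have "\<dots> = P i * D i * B (Suc i)" using Suc by simp
  also have "\<dots> = P (Suc i) * D (Suc i)" unfolding P_Suc
    using c Suc.prems D_Suc[of i] by (simp add: mat_mult_assoc)
  finally show ?case .
qed (use A in \<open>simp add: mat_prod_list_def D_0\<close>)

lemma intertwine_Q: "i \<le> k \<Longrightarrow> Q i * A = D i * Q i"
proof (induction i)
  case (Suc i)
  note c = A Q_carrier[of i] factors[of i]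
  have "Q (Suc i) * A = C (Suc i) * (Q i * A)" using c Suc.prems by (simp add: mat_mult_assoc)
  also have "\<dots> = C (Suc i) * (D i * Q i)" using Suc by simp
  also have "\<dots> = D (Suc i) * Q (Suc i)"
    using c Suc.prems D_Suc[of i] by (simp add: mat_mult_assoc)
  finally show ?case .
qed (use A in \<open>simp add: D_0\<close>)

lemma power_eq: "i \<le> k \<Longrightarrow> A ^\<^sub>m i = P i * Q i"
proof (induction i)
  case (Suc i)
  note c = A P_carrier[of i] Q_carrier[of i] factors[of i]
  have "A ^\<^sub>m Suc i = P i * (Q i * A)" using c Suc by (simp add: mat_mult_assoc)
  also have "\<dots> = P i * (D i * Q i)" using intertwine_Q[of i] Suc.prems by simp
  also have "\<dots> = P (Suc i) * Q (Suc i)" unfolding P_Suc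
    using c Suc.prems by (simp add: mat_mult_assoc)
  finally show ?case .
qed (use A in \<open>simp add: mat_prod_list_def\<close>)

lemma P_left_inverse: "i \<le> k \<Longrightarrow> \<exists>L \<in> carrier_mat (r i) n. L * P i = 1\<^sub>m (r i)"
proof (induction i)
  case (Suc i)
  then obtain L where L: "L \<in> carrier_mat (r i) n" "L * P i = 1\<^sub>m (r i)" by auto
  have i: "i < k" using Suc.prems by simp
  note B = factors(1)[OF i]
  obtain M where M: "M \<in> carrier_mat (r (Suc i)) (r i)" "M * B (Suc i) = 1\<^sub>m (r (Suc i))"
    using full_column_rank_left_inverse[OF full_rank_factorizationD(6)[OF step[OF i]]]
      carrier_matD[OF B] by metis
  have "M * L * P (Suc i) = M * (L * P i * B (Suc i))"
    unfolding P_Suc using M(1) L(1) B P_carrier[of i] i by (simp add: mat_mult_assoc)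
  also have "\<dots> = 1\<^sub>m (r (Suc i))" unfolding L(2) using B M(2) by simp
  finally show ?case using M(1) L(1) by (meson mult_carrier_mat)
qed (auto simp: mat_prod_list_def r_0 intro!: bexI[of _ "1\<^sub>m n"])

lemma Q_right_inverse: "i \<le> k \<Longrightarrow> \<exists>R \<in> carrier_mat n (r i). Q i * R = 1\<^sub>m (r i)"
proof (induction i)
  case (Suc i)
  then obtain R where R: "R \<in> carrier_mat n (r i)" "Q i * R = 1\<^sub>m (r i)" by auto
  have i: "i < k" using Suc.prems by simp
  note C = factors(2)[OF i]
  obtain M where M: "M \<in> carrier_mat (r i) (r (Suc i))" "C (Suc i) * M = 1\<^sub>m (r (Suc i))"
    using full_row_rank_right_inverse[OF full_rank_factorizationD(7)[OF step[OF i]]]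
      carrier_matD[OF C] by metis
  have "Q (Suc i) * (R * M) = C (Suc i) * (Q i * R * M)"
    using M(1) R(1) C Q_carrier[of i] i by (simp add: mat_mult_assoc)
  also have "\<dots> = 1\<^sub>m (r (Suc i))" unfolding R(2) using M by simp
  finally show ?case using M(1) R(1) by (meson mult_carrier_mat)
qed (auto simp: r_0 intro!: bexI[of _ "1\<^sub>m n"])

text \<open>With a right inverse \<open>R\<close> of \<open>Q\<^sub>i\<close>, one has \<open>Q\<^sub>i P\<^sub>i = Q\<^sub>i P\<^sub>i Q\<^sub>i R = Q\<^sub>i A\<^sup>i R = D\<^sub>i\<^sup>i Q\<^sub>i R = D\<^sub>i\<^sup>i\<close>.\<close>
lemma QP_power: "i \<le> k \<Longrightarrow> Q i * P i = D i ^\<^sub>m i"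
proof -
  assume i: "i \<le> k"
  note c = P_carrier[OF i] Q_carrier[OF i] D_carrier[OF i] A
  obtain R where R: "R \<in> carrier_mat n (r i)" "Q i * R = 1\<^sub>m (r i)"
    using Q_right_inverse[OF i] by blast
  have shift: "Q i * A ^\<^sub>m j = D i ^\<^sub>m j * Q i" for j
  proof (induction j)
    case (Suc j)
    have "Q i * A ^\<^sub>m Suc j = Q i * A ^\<^sub>m j * A" using c by (simp add: mat_mult_assoc)
    also have "\<dots> = D i ^\<^sub>m j * (Q i * A)" unfolding Suc using c by (simp add: mat_mult_assoc)
    also have "\<dots> = D i ^\<^sub>m Suc j * Q i"
      unfolding intertwine_Q[OF i] using c by (simp add: mat_mult_assoc)
    finally show ?case .
  qed (use c in simp)
  have "Q i * P i = Q i * (P i * Q i) * R" using c R by (simp add: mat_mult_assoc)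
  also have "\<dots> = D i ^\<^sub>m i * (Q i * R)"
    unfolding power_eq[OF i, symmetric] shift
    by (rule assoc_mult_mat[OF pow_carrier_mat[OF c(3)] c(2) R(1)])
  finally show ?thesis unfolding R(2) right_mult_one_mat[OF pow_carrier_mat[OF c(3)]] .
qed

text \<open>Compressing \<open>A\<^sup>k\<close> by one-sided inverses of \<open>P\<^sub>k\<close> and \<open>Q\<^sub>k\<close> yields an identity matrix, so its rank is at least
  the order of \<open>D\<^sub>k\<close>; at the index this rank equals that of \<open>A\<^sup>k\<^sup>+\<^sup>1 = P\<^sub>k D\<^sub>k Q\<^sub>k\<close>.\<close>
lemma D_index_invertible:
  assumes "mat_index A = k"
  shows "invertible_mat (D k)"
proof (rule full_rank_invertible)
  note c = P_carrier[OF order_refl] Q_carrier[OF order_refl] D_carrier[OF order_refl] A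
  show "D k \<in> carrier_mat (r k) (r k)" by (rule c)
  obtain L where L: "L \<in> carrier_mat (r k) n" "L * P k = 1\<^sub>m (r k)" using P_left_inverse by blast
  obtain R where R: "R \<in> carrier_mat n (r k)" "Q k * R = 1\<^sub>m (r k)" using Q_right_inverse by blast
  have "L * (A ^\<^sub>m k * R) = (L * P k) * (Q k * R)"
    unfolding power_eq[OF order_refl] using L(1) R(1) c by (simp add: mat_mult_assoc)
  then have "L * (A ^\<^sub>m k * R) = 1\<^sub>m (r k)" unfolding L(2) R(2) by simp
  then have "r k = mat_rank (L * (A ^\<^sub>m k * R))" by simp
  also have "\<dots> \<le> mat_rank (A ^\<^sub>m k * R)" using L(1) A by (intro mat_rank_mult_le_right) simp
  also have "\<dots> \<le> mat_rank (A ^\<^sub>m k)" using R(1) A by (intro mat_rank_mult_le_left) simp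
  also have "\<dots> = mat_rank (A ^\<^sub>m (k + 1))"
    using mat_index_rank_stable[OF A] unfolding assms by simp
  also have "A ^\<^sub>m (k + 1) = P k * (D k * Q k)"
    using c power_eq[OF order_refl] intertwine_Q[OF order_refl] by (simp add: mat_mult_assoc)
  also have "mat_rank \<dots> \<le> mat_rank (D k * Q k)" using c by (intro mat_rank_mult_le_right) simp
  also have "\<dots> \<le> mat_rank (D k)" using c by (intro mat_rank_mult_le_left) simp
  finally show "r k \<le> mat_rank (D k)" .
qed

text \<open>The list product \<open>C\<^sub>j \<cdots> C\<^sub>2\<close> becomes \<open>Q\<^sub>j\<close> after one more factor \<open>C\<^sub>1\<close>.  The accumulator \<open>M\<close> of the
  fold is arbitrary for the sake of the induction.\<close>
lemma tail_product:
  assumes "1 \<le> j" "j \<le> k" "dim_col M = r j"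
  shows "dim_row (foldl (*) M (map C (rev [2..<j + 1]))) = dim_row M"
    "dim_col (foldl (*) M (map C (rev [2..<j + 1]))) = r 1"
    "foldl (*) M (map C (rev [2..<j + 1])) * C 1 = M * Q j"
proof -
  let ?T = "\<lambda>j M. foldl (*) M (map C (rev [2..<j + 1]))"
  have "dim_row (?T j M) = dim_row M \<and> dim_col (?T j M) = r 1 \<and> ?T j M * C 1 = M * Q j"
    using assms
  proof (induction j arbitrary: M rule: dec_induct)
    case base
    then show ?case using factors(2)[of 0] by (simp add: r_0)
  next
    case (step j)
    have T: "?T (Suc j) M = ?T j (M * C (Suc j))" using step.hyps by simp
    note c = factors[of j] Q_carrier[of j]
    have "dim_col (M * C (Suc j)) = r j" using c step.prems by simp
    then show ?case unfolding T using step.IH[of "M * C (Suc j)"] step.prems c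
      by (simp add: mat_mult_assoc)
  qed
  then show "dim_row (?T j M) = dim_row M" "dim_col (?T j M) = r 1" "?T j M * C 1 = M * Q j"
    by auto
qed

text \<open>Both matrices are inner factors of \<open>A\<^sup>~ A A\<^sup>~\<close>, so their ranks are at least the rank of \<open>A\<close>, which is their
  order.\<close>
lemma minkowski_gram_invertible:
  assumes k: "1 \<le> k"
    and rank: "mat_rank (minkowski_adjoint A * A * minkowski_adjoint A) = mat_rank A"
  shows "invertible_mat (minkowski_adjoint (B 1) * B 1)"
    "invertible_mat (C 1 * minkowski_adjoint (C 1))"
proof -
  let ?B' = "minkowski_adjoint (B 1)" and ?C' = "minkowski_adjoint (C 1)"
  have B: "B 1 \<in> carrier_mat n (r 1)" and C: "C 1 \<in> carrier_mat (r 1) n" and BC: "A = B 1 * C 1"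
    using factors[of 0] k by (simp_all add: r_0 D_0)
  have r1: "r 1 = mat_rank A" using r_Suc[of 0] k by (simp add: D_0)
  have d: "dim_row (B 1) = n" "dim_col (B 1) = r 1" "dim_row (C 1) = r 1" "dim_col (C 1) = n"
    using B C by auto
  have adj: "minkowski_adjoint A = ?C' * ?B'" unfolding BC using d by (simp add: minkowski_adjoint_mult)
  have eq: "minkowski_adjoint A * A * minkowski_adjoint A = ?C' * (?B' * B 1 * (C 1 * ?C' * ?B'))"
    unfolding adj unfolding BC using d by (simp add: mat_mult_assoc)
  have "r 1 = mat_rank (?C' * (?B' * B 1 * (C 1 * ?C' * ?B')))" using rank eq r1 by simp
  also have "\<dots> \<le> mat_rank (?B' * B 1 * (C 1 * ?C' * ?B'))"
    by (rule mat_rank_mult_le_right) (use d in simp)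
  finally have le: "r 1 \<le> mat_rank (?B' * B 1 * (C 1 * ?C' * ?B'))" .
  also have "\<dots> \<le> mat_rank (?B' * B 1)" by (rule mat_rank_mult_le_left) (use d in simp)
  finally show "invertible_mat (?B' * B 1)"
    by (intro full_rank_invertible[of _ "r 1"] carrier_matI) (use d in simp_all)
  note le
  also have "mat_rank (?B' * B 1 * (C 1 * ?C' * ?B')) \<le> mat_rank (C 1 * ?C' * ?B')"
    by (rule mat_rank_mult_le_right) (use d in simp)
  also have "\<dots> \<le> mat_rank (C 1 * ?C')" by (rule mat_rank_mult_le_left) (use d in simp)
  finally show "invertible_mat (C 1 * ?C')"
    by (intro full_rank_invertible[of _ "r 1"] carrier_matI) (use d in simp_all)
qed

lemma m_DMP_inverse_formula:
  assumes k: "1 \<le> k" and index: "mat_index A = k"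
    and rank: "mat_rank (minkowski_adjoint A * A * minkowski_adjoint A) = mat_rank A"
  shows "m_DMP_inverse A =
    P k * mat_inv (D k) ^\<^sub>m k * mat_prod_list (dim_row (C k)) (map C (rev [2..<k + 1]))
    * mat_inv (minkowski_adjoint (B 1) * B 1) * minkowski_adjoint (B 1)"
proof -
  let ?B' = "minkowski_adjoint (B 1)" and ?C' = "minkowski_adjoint (C 1)"
  define E U V T where "E = mat_inv (D k)" and "U = mat_inv (?B' * B 1)"
    and "V = mat_inv (C 1 * ?C')"
    and "T = mat_prod_list (dim_row (C k)) (map C (rev [2..<k + 1]))"
  have B: "B 1 \<in> carrier_mat n (r 1)" and C: "C 1 \<in> carrier_mat (r 1) n" and BC: "A = B 1 * C 1"
    using factors[of 0] k by (simp_all add: r_0 D_0)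
  have d: "dim_row (B 1) = n" "dim_col (B 1) = r 1" "dim_row (C 1) = r 1" "dim_col (C 1) = n"
    using B C by auto
  note c = P_carrier[OF order_refl] Q_carrier[OF order_refl] D_carrier[OF order_refl] A
  note E = mat_inv_left_right[OF c(3) D_index_invertible[OF index], folded E_def]
  note inv = minkowski_gram_invertible[OF k rank]
  have gram: "?B' * B 1 \<in> carrier_mat (r 1) (r 1)" "C 1 * ?C' \<in> carrier_mat (r 1) (r 1)"
    using d by (auto intro!: carrier_matI)
  note U = mat_inv_left_right[OF gram(1) inv(1), folded U_def]
  note V = mat_inv_left_right[OF gram(2) inv(2), folded V_def]
  have "dim_row (C k) = r k" using factors(2)[of "k - 1"] k by simp
  then have T: "dim_row T = r k" "dim_col T = r 1" "T * C 1 = Q k"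
    using tail_product[OF k order_refl, of "1\<^sub>m (r k)"] c unfolding T_def mat_prod_list_def by simp_all
  have dims: "dim_row (P k) = n" "dim_col (P k) = r k" "dim_row E = r k" "dim_col E = r k"
    "dim_row U = r 1" "dim_col U = r 1" "dim_row V = r 1" "dim_col V = r 1"
    "dim_row (Q k) = r k" "dim_col (Q k) = n" "dim_row (D k) = r k" "dim_col (D k) = r k"
    "dim_row A = n" "dim_col A = n" "dim_row (E ^\<^sub>m k) = r k" "dim_col (E ^\<^sub>m k) = r k"
    using c E U V by auto
  have drazin: "drazin_inverse A = P k * E ^\<^sub>m (k + 1) * Q k"
    by (rule drazin_inverse_of_factorization[OF A c(1-3) E(1,2) index power_eq
          intertwine_P intertwine_Q QP_power]) simp_all
  have "drazin_inverse A * A = P k * E ^\<^sub>m k * (E * (Q k * A))"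
    unfolding drazin using dims by (simp add: mat_mult_assoc)
  also have "E * (Q k * A) = T * C 1"
    unfolding intertwine_Q[OF order_refl] T(3) using E(3) dims
    by (simp add: mat_mult_cancel_left[where m = "r k"])
  finally have DA: "drazin_inverse A * A = P k * E ^\<^sub>m k * (T * C 1)" .
  have mink: "minkowski_inverse A = ?C' * V * (U * ?B')"
    unfolding BC U_def V_def by (rule minkowski_inverse_of_factorization[OF B C inv])
  \<comment> \<open>the cancellation that removes \<open>C\<^sub>1\<close> from the formula\<close>
  have "C 1 * (?C' * (V * (U * ?B'))) = U * ?B'"
    using mat_mult_cancel_left[OF V(2), of "U * ?B'"] dims d by (simp add: mat_mult_assoc)
  then have "m_DMP_inverse A = P k * E ^\<^sub>m k * T * U * ?B'"
    unfolding m_DMP_inverse_def DA mink using dims d T(1,2) by (simp add: mat_mult_assoc)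
  then show ?thesis unfolding E_def T_def U_def .
qed

end

theorem theorem4p4:
  fixes n k :: nat and A :: "complex mat" and B C :: "nat \<Rightarrow> complex mat"
  assumes "A \<in> carrier_mat n n"
    and "mat_index A = k" and "k \<ge> 1"
    and "mat_rank (minkowski_adjoint A * A * minkowski_adjoint A) = mat_rank A"
    and "mat_rank A > 0"
    and "A ^\<^sub>m k \<noteq> 0\<^sub>m n n"
    and "full_rank_factorization A (B 1) (C 1)"
    and "\<And>i. 1 \<le> i \<Longrightarrow> i \<le> k - 1 \<Longrightarrow>
           full_rank_factorization (C i * B i) (B (i + 1)) (C (i + 1))"
  shows "invertible_mat (C k * B k) \<and>
         invertible_mat (minkowski_adjoint (B 1) * B 1) \<and>
         m_DMP_inverse A =
           mat_prod_list n (map B [1..<k + 1])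
           * (mat_inv (C k * B k)) ^\<^sub>m k
           * mat_prod_list (dim_row (C k)) (map C (rev [2..<k + 1]))
           * mat_inv (minkowski_adjoint (B 1) * B 1)
           * minkowski_adjoint (B 1)"
proof -
  define D where "D i = (if i = 0 then A else C i * B i)" for i
  interpret iterated_factorization n k A B C D
  proof
    show "full_rank_factorization (D i) (B (Suc i)) (C (Suc i))" if "i < k" for i
      using assms(7) assms(8)[of i] that by (cases "i = 0") (auto simp: D_def)
  qed (use assms(1) in \<open>auto simp: D_def\<close>)
  have Dk: "D k = C k * B k" using assms(3) by (simp add: D_def)
  show ?thesis
    using D_index_invertible[OF assms(2)] minkowski_gram_invertible(1)[OF assms(3,4)]
      m_DMP_inverse_formula[OF assms(3,2,4)]
    unfolding Dk by blast
qed

end
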